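(* Let $f:\mathbb{R}^n\to\mathbb{R}$ be a continuous scaling-invariant function. Then for all $\alpha>0$, there exist a continuous positively homogeneous function $p:\mathbb{R}^n\to\mathbb{R}$ with degree $\alpha$ and a strictly increasing and continuous bijection (thus a homeomorphism) $\varphi$ such that $f=\varphi\circ p$. For a non-zero $f$ and $\alpha>0$, the choice of $(\varphi,p)$ is unique up to a left composition of $p$ with a piece-wise linear function. If $f$ admits a global optimum, then $0$ is also a global optimum; and in this case, for any $x_0\in\mathbb{R}^n$ such that $f(x_0)\neq 0$, in the case where $p$ is positively homogeneous with degree $1$, the homeomorphism $\varphi$ can be chosen as $f_{x_0}$ and is at least as smooth as $f$. If $f$ does not admit a global optimum, then there exist $x_1,x_{-1}\in\mathbb{R}^n$ such that $f(x_1)>0$ and $f(x_{-1})<0$. For any such $x_1$ and $x_{-1}$, in the case where $p$ is positively homogeneous with degree $1$, the homeomorphism $\varphi$ can be chosen as the function equal to $f_{x_1}$ on $[0,\infty)$ and equal to $t\mapsto f_{x_{-1}}(-t)$ on $(-\infty,0]$.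
   Context: A function $f:\mathbb{R}^n\to\mathbb{R}$ is scaling-invariant (with respect to $0$) if for all $x,y\in\mathbb{R}^n$ and $\rho>0$: $f(x)\le f(y)\iff f(\rho x)\le f(\rho y)$. Standing convention: scaling-invariant functions are normalized so that the reference point is $0$ and $f(0)=0$. For $x\in\mathbb{R}^n$, $f_x:[0,\infty)\to\mathbb{R}$ is defined by $f_x(t)=f(tx)$. A function $p:\mathbb{R}^n\to\mathbb{R}$ is positively homogeneous with degree $\alpha>0$ if $p(\rho x)=\rho^\alpha p(x)$ for all $x\in\mathbb{R}^n$ and $\rho>0$. The function $\varphi$ is defined on an interval of $\mathbb{R}$ containing the image $\mathrm{Im}(p)$ and is a bijection onto its image. A global optimum is a global argmin or a global argmax. "Unique up to a left composition of $p$ with a piece-wise linear function" means: if $f=\varphi\circ p=\bar\varphi\circ\bar p$ are two such decompositions (same $\alpha$), then $\bar p=\psi\circ p$ where $\psi$ is a function on $\mathrm{Im}(p)$ that is linear on $\mathrm{Im}(p)\cap[0,\infty)$ and linear on $\mathrm{Im}(p)\cap(-\infty,0]$. "At least as smooth as $f$" means that if $f$ is of class $C^k$ then so is $f_{x_0}$.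
   Formalization: If the global optimum is a maximum, f_{x_0} is strictly decreasing (e.g. f(x) = −|x|), so it cannot be the strictly increasing φ; the formal theorem says f_{x_0} is a homeomorphism with f = f_{x_0}∘p, strictly increasing for a minimum and strictly decreasing for a maximum. *)

theory Defs
  imports "HOL-Analysis.Analysis"
begin

definition scaling_invariant :: "('a::real_vector \<Rightarrow> real) \<Rightarrow> bool" where
  "scaling_invariant f \<longleftrightarrow>
    (\<forall>x y. \<forall>\<rho>>0. f x \<le> f y \<longleftrightarrow> f (\<rho> *\<^sub>R x) \<le> f (\<rho> *\<^sub>R y))"

definition pos_homogeneous :: "real \<Rightarrow> ('a::real_vector \<Rightarrow> real) \<Rightarrow> bool" where
  "pos_homogeneous \<alpha> p \<longleftrightarrow> (\<forall>x. \<forall>\<rho>>0. p (\<rho> *\<^sub>R x) = \<rho> powr \<alpha> * p x)"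

text \<open>The function $f_x$; only its values on $[0,\infty)$ are meant.\<close>

definition ray_fun :: "('a::real_vector \<Rightarrow> real) \<Rightarrow> 'a \<Rightarrow> real \<Rightarrow> real" where
  "ray_fun f x t = f (t *\<^sub>R x)"

definition two_ray_fun :: "('a::real_vector \<Rightarrow> real) \<Rightarrow> 'a \<Rightarrow> 'a \<Rightarrow> real \<Rightarrow> real" where
  "two_ray_fun f x y t = (if 0 \<le> t then ray_fun f x t else ray_fun f y (- t))"

definition global_optimum :: "('a \<Rightarrow> real) \<Rightarrow> 'a \<Rightarrow> bool" where
  "global_optimum f x \<longleftrightarrow> is_arg_min f (\<lambda>_. True) x \<or> is_arg_max f (\<lambda>_. True) x"

text \<open>
  $f = \varphi \circ p$, where $\varphi$ is a continuous bijection from an interval $I$ onto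
  its image $\varphi(I)$. Only the values of $\varphi$ on $I$ matter. The monotonicity of
  $\varphi$ is stated separately, because the choice $\varphi = f_{x_0}$ is strictly decreasing
  on $[0,\infty)$ when $f$ has a global maximum, e.g. for $f(x) = -|x|$.
\<close>

definition decomposition ::
  "('a::real_normed_vector \<Rightarrow> real) \<Rightarrow> real \<Rightarrow> real set \<Rightarrow> (real \<Rightarrow> real) \<Rightarrow> ('a \<Rightarrow> real) \<Rightarrow> bool" where
  "decomposition f \<alpha> I \<phi> p \<longleftrightarrow>
     is_interval I \<and> range p \<subseteq> I \<and>
     continuous_on I \<phi> \<and> bij_betw \<phi> I (\<phi> ` I) \<and>
     continuous_on UNIV p \<and> pos_homogeneous \<alpha> p \<and>
     f = \<phi> \<circ> p"

definition homeomorphic_onto_image :: "real set \<Rightarrow> (real \<Rightarrow> real) \<Rightarrow> bool" where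
  "homeomorphic_onto_image I \<phi> \<longleftrightarrow> (\<exists>g. homeomorphism I (\<phi> ` I) \<phi> g)"

definition piecewise_linear_on :: "real set \<Rightarrow> (real \<Rightarrow> real) \<Rightarrow> bool" where
  "piecewise_linear_on A \<psi> \<longleftrightarrow>
     (\<exists>a. \<forall>t\<in>A \<inter> {0..}. \<psi> t = a * t) \<and> (\<exists>b. \<forall>t\<in>A \<inter> {..0}. \<psi> t = b * t)"

text \<open>
  Class $C^k$ on \<open>S\<close>, by iterated directional derivatives taken within \<open>S\<close>. It is used for
  \<open>S = UNIV\<close> and for \<open>S = {0..}\<close> (one-sided derivatives at \<open>0\<close>), where derivatives within
  \<open>S\<close> are unique.
\<close>

primrec class_C_on ::
  "nat \<Rightarrow> ('a::real_normed_vector \<Rightarrow> 'b::real_normed_vector) \<Rightarrow> 'a set \<Rightarrow> bool" where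
  "class_C_on 0 f S \<longleftrightarrow> continuous_on S f"
| "class_C_on (Suc k) f S \<longleftrightarrow>
     (\<forall>x\<in>S. f differentiable (at x within S)) \<and>
     (\<forall>v. class_C_on k (\<lambda>x. frechet_derivative f (at x within S) v) S)"

end

theory Submission
  imports Defs
begin

text \<open>
  On a ray through a point \<open>x\<close> with \<open>f x > 0\<close>, a continuous scaling-invariant \<open>f\<close> is strictly
  increasing: if \<open>f x \<le> f (r x)\<close> for some \<open>0 < r < 1\<close>, then \<open>f x \<le> f (r\<^sup>n x)\<close> for all \<open>n\<close>,
  and \<open>n \<rightarrow> \<infinity>\<close> gives \<open>f x \<le> f 0 = 0\<close>. The ray also attains every nonnegative value \<open>f y\<close>:
  if \<open>f (n x) < f y\<close> for all \<open>n\<close>, then \<open>f x < f (y / n)\<close>, and again \<open>f x \<le> 0\<close>. Hence one positive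
  and one negative ray (whichever exist) parametrize the level sets of \<open>f\<close>, and \<open>p y\<close> is the
  parameter at which the parametrization takes the value \<open>f y\<close>. Scaling invariance makes \<open>p\<close>
  homogeneous, and its values are forced up to one scalar for each sign.
\<close>

section \<open>Signed powers on the real line\<close>

text \<open>The odd extension of the power function. Substituting
  \<open>signed_powr (1 / \<alpha>)\<close> into a parametrization of degree 1 turns it into one of
  degree \<alpha>.\<close>

definition signed_powr :: "real \<Rightarrow> real \<Rightarrow> real" where
  "signed_powr a t = (if 0 \<le> t then t powr a else - ((- t) powr a))"

lemma signed_powr_one [simp]: "signed_powr 1 t = t"
  by (simp add: signed_powr_def)

lemma signed_powr_pos_iff: "0 < signed_powr a t \<longleftrightarrow> 0 < t"
  by (auto simp: signed_powr_def less_le)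

lemma signed_powr_neg_iff: "signed_powr a t < 0 \<longleftrightarrow> t < 0"
  by (simp add: signed_powr_def)

lemma signed_powr_mult:
  assumes "0 < \<rho>"
  shows "signed_powr a (\<rho> * t) = \<rho> powr a * signed_powr a t"
  using assms powr_mult[of \<rho> t a] powr_mult[of \<rho> "- t" a]
  by (simp add: signed_powr_def zero_le_mult_iff)

lemma signed_powr_inverse:
  assumes "a \<noteq> 0"
  shows "signed_powr (1 / a) (signed_powr a t) = t"
  using assms by (auto simp: signed_powr_def powr_powr)

lemma strict_mono_signed_powr:
  assumes "0 < a"
  shows "strict_mono (signed_powr a)"
proof (rule strict_monoI)
  fix s t :: real
  assume "s < t"
  consider "0 \<le> s" | "s < 0" "0 \<le> t" | "t < 0" by linarith
  then show "signed_powr a s < signed_powr a t"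
  proof cases
    case 1
    with \<open>s < t\<close> assms show ?thesis by (simp add: signed_powr_def powr_less_mono2)
  next
    case 2
    then have "- ((- s) powr a) < 0" by simp
    also have "0 \<le> t powr a" by simp
    finally show ?thesis using 2 by (simp add: signed_powr_def)
  next
    case 3
    with \<open>s < t\<close> assms show ?thesis by (simp add: signed_powr_def powr_less_mono2)
  qed
qed

lemma continuous_on_signed_powr:
  assumes "0 < a"
  shows "continuous_on S (signed_powr a)"
proof -
  \<comment> \<open>Since \<open>0 powr a = 0\<close>, each term vanishes on the half-line where the
    other one acts, so no gluing at 0 is required.\<close>
  have "signed_powr a = (\<lambda>t. max t 0 powr a - max (- t) 0 powr a)"
    by (auto simp: signed_powr_def)
  moreover have "continuous_on S (\<lambda>t::real. max t 0 powr a - max (- t) 0 powr a)"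
    using assms by (intro continuous_intros continuous_on_powr') auto
  ultimately show ?thesis by simp
qed

section \<open>From parametrizations of the level sets to decompositions\<close>

text \<open>An injective continuous function on an interval is strictly monotone, so its inverse is
  continuous even if the interval is not compact.\<close>

lemma homeomorphic_onto_image_real:
  assumes "is_interval I" "continuous_on I \<phi>" "inj_on \<phi> I"
  shows "homeomorphic_onto_image I \<phi>"
  unfolding homeomorphic_onto_image_def
  using assms homeomorphism_into_1d[of I \<phi> "\<phi> ` I"]
  by (simp add: is_interval_path_connected_1)

text \<open>Take \<open>p = g \<circ> f\<close> with \<open>g\<close> the inverse of
  \<open>\<phi>\<close>. By \<open>scale\<close>, scaling a point scales its parameter, and
  \<open>cone\<close> keeps the new parameter in \<open>I\<close>, where \<open>g\<close> inverts
  \<open>\<phi>\<close>. Both the one-ray and the two-ray parametrizations are handled this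
  way.\<close>

lemma decomposition_of_parametrization:
  assumes "is_interval I" "continuous_on I \<phi>" "inj_on \<phi> I" "continuous_on UNIV f"
    and range: "range f \<subseteq> \<phi> ` I"
    and cone: "\<And>t \<rho>. t \<in> I \<Longrightarrow> 0 < \<rho> \<Longrightarrow> \<rho> * t \<in> I"
    and scale: "\<And>y t \<rho>. t \<in> I \<Longrightarrow> f y = \<phi> t \<Longrightarrow> 0 < \<rho> \<Longrightarrow> f (\<rho> *\<^sub>R y) = \<phi> (\<rho> powr \<alpha> * t)"
  shows "\<exists>p. decomposition f \<alpha> I \<phi> p"
proof -
  obtain g where g: "homeomorphism I (\<phi> ` I) \<phi> g"
    using homeomorphic_onto_image_real[OF assms(1-3)]
    unfolding homeomorphic_onto_image_def by blast
  have g\<phi>: "g (\<phi> t) = t" if "t \<in> I" for t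
    using g that by (rule homeomorphism_apply1)
  have gI: "g (f y) \<in> I" and \<phi>g: "\<phi> (g (f y)) = f y" for y
    using range g\<phi> by (metis imageE rangeI subsetD)+
  have "g (f (\<rho> *\<^sub>R y)) = \<rho> powr \<alpha> * g (f y)" if "0 < \<rho>" for \<rho> y
    using scale[OF gI \<phi>g[symmetric] that] g\<phi>[OF cone[OF gI]] that by simp
  then have "pos_homogeneous \<alpha> (g \<circ> f)"
    by (simp add: pos_homogeneous_def)
  moreover have "continuous_on UNIV (g \<circ> f)"
    using continuous_on_compose[OF assms(4)] continuous_on_subset[OF homeomorphism_cont2[OF g] range]
    by blast
  ultimately have "decomposition f \<alpha> I \<phi> (g \<circ> f)"
    using assms(1-3) gI \<phi>g by (auto simp: decomposition_def bij_betw_def fun_eq_iff)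
  then show ?thesis by blast
qed

text \<open>Scaling by 2 fixes the origin but multiplies \<open>p 0\<close> by
  \<open>2 powr \<alpha>\<close>, which is not 1.\<close>

lemma pos_homogeneous_zero:
  assumes "pos_homogeneous \<alpha> p" "\<alpha> \<noteq> 0"
  shows "p 0 = 0"
proof -
  have "p ((2::real) *\<^sub>R 0) = 2 powr \<alpha> * p 0"
    using assms(1) unfolding pos_homogeneous_def by (metis zero_less_numeral)
  moreover have "(2::real) powr \<alpha> \<noteq> 1"
    using assms(2) by simp
  ultimately show ?thesis by simp
qed

section \<open>Smoothness along a ray\<close>

lemma class_C_on_cong:
  assumes "\<And>x. x \<in> S \<Longrightarrow> f x = g x"
  shows "class_C_on k f S \<longleftrightarrow> class_C_on k g S"
  using assms
proof (induction k arbitrary: f g)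
  case 0
  then show ?case using continuous_on_cong[of S S f g] by simp
next
  case (Suc k)
  have hd: "(f has_derivative D) (at x within S) \<longleftrightarrow> (g has_derivative D) (at x within S)"
    if "x \<in> S" for x D
    using that Suc.prems by (metis has_derivative_transform)
  \<comment> \<open>\<open>frechet_derivative\<close> is a Hilbert choice from the set of
    derivatives, so equal sets give equal choices, even where no derivative exists.\<close>
  have "frechet_derivative f (at x within S) = frechet_derivative g (at x within S)"
    if "x \<in> S" for x
    unfolding frechet_derivative_def using hd[OF that] by simp
  then have "class_C_on k (\<lambda>x. frechet_derivative f (at x within S) v) S \<longleftrightarrow>
      class_C_on k (\<lambda>x. frechet_derivative g (at x within S) v) S" for v
    by (intro Suc.IH) simp
  moreover have "f differentiable (at x within S) \<longleftrightarrow> g differentiable (at x within S)"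
    if "x \<in> S" for x
    unfolding differentiable_def using hd[OF that] by simp
  ultimately show ?case by simp
qed

text \<open>Derivatives stay unique at the endpoint \<open>a\<close>, because arbitrarily small
  displacements to the right remain in the half-line.\<close>

lemma frechet_derivative_atLeast:
  fixes h :: "real \<Rightarrow> 'b::real_normed_vector"
  assumes "(h has_derivative D) (at t within {a..})" "t \<in> {a..}"
  shows "frechet_derivative h (at t within {a..}) = D"
proof -
  have "(h has_derivative frechet_derivative h (at t within {a..})) (at t within {a..})"
    using assms(1) differentiableI frechet_derivative_works by blast
  then show ?thesis
  proof (rule frechet_derivative_unique_within[OF _ assms(1)])
    fix i :: real and e :: real
    assume "i \<in> Basis" "0 < e"
    then show "\<exists>d. 0 < \<bar>d\<bar> \<and> \<bar>d\<bar> < e \<and> t + d *\<^sub>R i \<in> {a..}"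
      using assms(2) by (intro exI[of _ "e / 2"]) auto
  qed
qed

text \<open>By the chain rule, the derivative of \<open>ray_fun f x\<close> in direction
  \<open>v\<close> is again a ray function, that of the derivative of \<open>f\<close> in direction
  \<open>v *\<^sub>R x\<close>. Hence the induction on \<open>k\<close> is generalized over
  \<open>f\<close>.\<close>

lemma class_C_on_ray_fun:
  fixes f :: "'a::real_normed_vector \<Rightarrow> real"
  assumes "class_C_on k f UNIV"
  shows "class_C_on k (ray_fun f x) {0..}"
  using assms
proof (induction k arbitrary: f)
  case 0
  then show ?case
    by (auto simp: ray_fun_def[abs_def] intro!: continuous_intros continuous_on_compose2[of UNIV f])
next
  case (Suc k)
  have hd: "(ray_fun f x has_derivative (\<lambda>v. frechet_derivative f (at (t *\<^sub>R x)) (v *\<^sub>R x)))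
      (at t within {0..})" for t
  proof -
    have "(f has_derivative frechet_derivative f (at (t *\<^sub>R x))) (at (t *\<^sub>R x))"
      using Suc.prems by (simp add: frechet_derivative_works)
    then show ?thesis
      unfolding ray_fun_def[abs_def]
      by (rule has_derivative_compose[rotated]) (auto intro!: derivative_eq_intros)
  qed
  have "class_C_on k (\<lambda>t. frechet_derivative (ray_fun f x) (at t within {0..}) v) {0..}" for v
  proof -
    have "class_C_on k (ray_fun (\<lambda>y. frechet_derivative f (at y) (v *\<^sub>R x)) x) {0..}"
      using Suc.prems by (intro Suc.IH) simp
    then show ?thesis
      by (subst class_C_on_cong[where g = "ray_fun (\<lambda>y. frechet_derivative f (at y) (v *\<^sub>R x)) x"])
        (simp_all add: frechet_derivative_atLeast[OF hd] ray_fun_def)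
  qed
  then show ?case
    using hd by (auto simp: differentiable_def)
qed

section \<open>Continuous scaling-invariant functions along a single ray\<close>

locale continuous_scaling_invariant =
  fixes f :: "'a::real_normed_vector \<Rightarrow> real"
  assumes continuous: "continuous_on UNIV f"
    and invariant: "scaling_invariant f"
    and zero [simp]: "f 0 = 0"
begin

text \<open>Negation only swaps the sides of each comparison. Results about positive values thus
  transfer to negative values.\<close>

lemma uminus: "continuous_scaling_invariant (\<lambda>x. - f x)"
proof
  show "continuous_on UNIV (\<lambda>x. - f x)"
    using continuous by (rule continuous_on_minus)
  show "scaling_invariant (\<lambda>x. - f x)"
    using invariant unfolding scaling_invariant_def neg_le_iff_le by blast
qed simp

lemma scale_le_iff: "0 < \<rho> \<Longrightarrow> f (\<rho> *\<^sub>R x) \<le> f (\<rho> *\<^sub>R y) \<longleftrightarrow> f x \<le> f y"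
  using invariant unfolding scaling_invariant_def by blast

lemma scale_less_iff: "0 < \<rho> \<Longrightarrow> f (\<rho> *\<^sub>R x) < f (\<rho> *\<^sub>R y) \<longleftrightarrow> f x < f y"
  by (simp add: scale_le_iff flip: not_le)

lemma scale_eq_iff: "0 < \<rho> \<Longrightarrow> f (\<rho> *\<^sub>R x) = f (\<rho> *\<^sub>R y) \<longleftrightarrow> f x = f y"
  by (simp add: scale_le_iff order_eq_iff)

text \<open>Every scaling fixes the origin, where \<open>f\<close> is 0, so comparison with the
  origin shows that the sign of \<open>f\<close> is constant on open rays.\<close>

lemma scale_pos_iff: "0 < \<rho> \<Longrightarrow> 0 < f (\<rho> *\<^sub>R x) \<longleftrightarrow> 0 < f x"
  using scale_less_iff[of \<rho> 0 x] by simp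

lemma scale_neg_iff: "0 < \<rho> \<Longrightarrow> f (\<rho> *\<^sub>R x) < 0 \<longleftrightarrow> f x < 0"
  using scale_less_iff[of \<rho> x 0] by simp

lemma continuous_on_ray: "continuous_on S (ray_fun f x)"
  unfolding ray_fun_def[abs_def]
  by (intro continuous_on_compose2[OF continuous] continuous_intros) auto

lemma tendsto_along_null_scaling:
  assumes "c \<longlonglongrightarrow> 0"
  shows "(\<lambda>n. f (c n *\<^sub>R x)) \<longlonglongrightarrow> 0"
proof -
  have "(\<lambda>n. c n *\<^sub>R x) \<longlonglongrightarrow> 0"
    using tendsto_scaleR[OF assms tendsto_const[of x]] by simp
  moreover have "isCont f 0"
    using continuous by (simp add: continuous_on_eq_continuous_at)
  ultimately show ?thesis
    using isCont_tendsto_compose by force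
qed

lemma shrink_less:
  assumes "0 < f x" "0 < r" "r < 1"
  shows "f (r *\<^sub>R x) < f x"
proof (rule ccontr)
  assume "\<not> ?thesis"
  then have step: "f x \<le> f (r *\<^sub>R x)" by simp
  have "f x \<le> f (r ^ n *\<^sub>R x)" for n
  proof (induction n)
    case (Suc n)
    \<comment> \<open>By invariance \<open>step\<close> holds at every scale; at scale
      \<open>r ^ n\<close> it links consecutive terms of the chain.\<close>
    have "f (r ^ n *\<^sub>R x) \<le> f (r ^ n *\<^sub>R (r *\<^sub>R x))"
      using step \<open>0 < r\<close> by (simp only: scale_le_iff zero_less_power)
    with Suc show ?case by (simp add: mult.commute)
  qed simp
  moreover have "(\<lambda>n. f (r ^ n *\<^sub>R x)) \<longlonglongrightarrow> 0"
    using assms by (intro tendsto_along_null_scaling LIMSEQ_realpow_zero) auto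
  ultimately have "f x \<le> 0"
    using LIMSEQ_le_const by blast
  with assms show False by simp
qed

lemma ray_strict_mono:
  assumes "0 < f x"
  shows "strict_mono_on {0..} (ray_fun f x)"
proof (rule strict_mono_onI)
  fix s t :: real
  assume *: "s \<in> {0..}" "t \<in> {0..}" "s < t"
  show "ray_fun f x s < ray_fun f x t"
  \<comment> \<open>\<open>shrink_less\<close> requires a positive ratio \<open>s / t\<close>, so
    \<open>s = 0\<close> is settled by the sign of \<open>f\<close> on the ray.\<close>
  proof (cases "s = 0")
    case True
    with * assms show ?thesis by (simp add: ray_fun_def scale_pos_iff)
  next
    case False
    with * assms have "f ((s / t) *\<^sub>R (t *\<^sub>R x)) < f (t *\<^sub>R x)"
      by (intro shrink_less) (auto simp: scale_pos_iff)
    with * show ?thesis by (simp add: ray_fun_def)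
  qed
qed

lemma ray_surj:
  assumes "0 < f x" "0 \<le> f y"
  obtains t where "0 \<le> t" "f (t *\<^sub>R x) = f y"
proof -
  have "\<exists>t>0. f y \<le> f (t *\<^sub>R x)"
  proof (rule ccontr)
    assume *: "\<not> ?thesis"
    \<comment> \<open>Dividing the comparison by \<open>Suc n\<close> moves the large multiple away
      from \<open>x\<close> and leaves a point tending to the origin on the side of
      \<open>y\<close>. \<open>Suc n\<close> keeps the factor nonzero.\<close>
    have "f x \<le> f (inverse (real (Suc n)) *\<^sub>R y)" for n
    proof -
      have "f (real (Suc n) *\<^sub>R x) < f y"
        using * by (metis not_le of_nat_0_less_iff zero_less_Suc)
      then show ?thesis
        using scale_less_iff[of "inverse (real (Suc n))" "real (Suc n) *\<^sub>R x" y] by simp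
    qed
    moreover have "(\<lambda>n. f (inverse (real (Suc n)) *\<^sub>R y)) \<longlonglongrightarrow> 0"
      by (intro tendsto_along_null_scaling LIMSEQ_inverse_real_of_nat)
    ultimately have "f x \<le> 0"
      using LIMSEQ_le_const by blast
    with assms show False by simp
  qed
  then obtain u where u: "0 < u" "f y \<le> ray_fun f x u"
    by (auto simp: ray_fun_def)
  have "ray_fun f x 0 \<le> f y"
    using assms by (simp add: ray_fun_def)
  with u obtain t where "0 \<le> t" "ray_fun f x t = f y"
    using IVT'[of "ray_fun f x" 0 "f y" u] continuous_on_ray by auto
  then show thesis
    using that by (simp add: ray_fun_def)
qed

lemma ray_strict_antimono:
  assumes "f x < 0"
  shows "strict_antimono_on {0..} (ray_fun f x)"
  using continuous_scaling_invariant.ray_strict_mono[OF uminus, of x] assms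
  by (simp add: monotone_on_def ray_fun_def)

lemma ray_surj_neg:
  assumes "f x < 0" "f y \<le> 0"
  obtains t where "0 \<le> t" "f (t *\<^sub>R x) = f y"
  using continuous_scaling_invariant.ray_surj[OF uminus, of x y] assms that by auto

lemma ray_inj:
  assumes "f x \<noteq> 0"
  shows "inj_on (ray_fun f x) {0..}"
proof (rule linorder_inj_onI)
  fix s t :: real
  assume "s < t" "s \<in> {0..}" "t \<in> {0..}"
  with assms show "ray_fun f x s \<noteq> ray_fun f x t"
    using ray_strict_mono[of x] ray_strict_antimono[of x]
    by (cases "0 < f x") (fastforce simp: monotone_on_def)+
qed auto

lemma ray_homeomorphic:
  assumes "f x \<noteq> 0"
  shows "homeomorphic_onto_image {0..} (ray_fun f x)"
  using assms by (intro homeomorphic_onto_image_real continuous_on_ray ray_inj) (auto simp: is_interval_ci)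

text \<open>The constant sign of \<open>f\<close> is that of \<open>f x\<close>, so a single ray
  reaches every value of \<open>f\<close>. The parametrization increases or decreases according to
  that sign.\<close>

lemma ray_decomposition:
  assumes "f x \<noteq> 0" and sgn: "(\<forall>y. 0 \<le> f y) \<or> (\<forall>y. f y \<le> 0)"
  shows "\<exists>p. decomposition f 1 {0..} (ray_fun f x) p"
proof (rule decomposition_of_parametrization)
  show "inj_on (ray_fun f x) {0..}"
    using assms by (intro ray_inj)
  show "range f \<subseteq> ray_fun f x ` {0..}"
  proof
    fix z assume "z \<in> range f"
    then obtain y where z: "z = f y" by auto
    obtain t where "0 \<le> t" "f (t *\<^sub>R x) = f y"
      using ray_surj[of x y] ray_surj_neg[of x y] assms
      by (metis order_le_less)
    with z show "z \<in> ray_fun f x ` {0..}" by (auto simp: ray_fun_def intro!: image_eqI)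
  qed
  show "f (\<rho> *\<^sub>R y) = ray_fun f x (\<rho> powr 1 * t)" if "f y = ray_fun f x t" "0 < \<rho>" for y t \<rho>
    using that scale_eq_iff[of \<rho> y "t *\<^sub>R x"] by (simp add: ray_fun_def)
qed (use continuous in \<open>auto simp: is_interval_ci continuous_on_ray\<close>)

section \<open>Two rays glued at the origin\<close>

lemma two_ray_pos: "0 < f x\<^sub>1 \<Longrightarrow> 0 < t \<Longrightarrow> 0 < two_ray_fun f x\<^sub>1 x\<^sub>2 t"
  by (simp add: two_ray_fun_def ray_fun_def scale_pos_iff)

lemma two_ray_neg: "f x\<^sub>2 < 0 \<Longrightarrow> t < 0 \<Longrightarrow> two_ray_fun f x\<^sub>1 x\<^sub>2 t < 0"
  using scale_neg_iff[of "- t" x\<^sub>2] by (simp add: two_ray_fun_def ray_fun_def)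

lemma two_ray_zero [simp]: "two_ray_fun f x\<^sub>1 x\<^sub>2 0 = 0"
  by (simp add: two_ray_fun_def ray_fun_def)

text \<open>Each sign condition is imposed only if \<open>I\<close> reaches that side, so a ray may
  be arbitrary when \<open>f\<close> does not take the corresponding sign.\<close>

lemma two_ray_strict_mono:
  assumes pos: "\<And>t. t \<in> I \<Longrightarrow> 0 < t \<Longrightarrow> 0 < f x\<^sub>1"
    and neg: "\<And>t. t \<in> I \<Longrightarrow> t < 0 \<Longrightarrow> f x\<^sub>2 < 0"
  shows "strict_mono_on I (two_ray_fun f x\<^sub>1 x\<^sub>2)"
proof (rule strict_mono_onI)
  fix s t :: real
  assume *: "s \<in> I" "t \<in> I" "s < t"
  consider "0 \<le> s" | "s < 0" "0 < t" | "s < 0" "t = 0" | "t < 0" by linarith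
  then show "two_ray_fun f x\<^sub>1 x\<^sub>2 s < two_ray_fun f x\<^sub>1 x\<^sub>2 t"
  proof cases
    case 1
    with * pos[of t] ray_strict_mono[of x\<^sub>1] show ?thesis
      by (simp add: two_ray_fun_def monotone_on_def)
  next
    case 2
    with * pos[of t] neg[of s] show ?thesis
      using two_ray_neg[of x\<^sub>2 s x\<^sub>1] two_ray_pos[of x\<^sub>1 t x\<^sub>2] by linarith
  next
    case 3
    with * neg[of s] show ?thesis
      using two_ray_neg[of x\<^sub>2 s x\<^sub>1] by simp
  next
    case 4
    \<comment> \<open>The reflection of the parameter compensates the decrease of \<open>f\<close>
      along the negative ray.\<close>
    with * neg[of s] ray_strict_antimono[of x\<^sub>2] show ?thesis
      by (simp add: two_ray_fun_def monotone_on_def)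
  qed
qed

lemma continuous_on_two_ray: "continuous_on S (two_ray_fun f x\<^sub>1 x\<^sub>2)"
proof -
  \<comment> \<open>At most one of the two points differs from the origin, and the other one
    contributes \<open>f 0 = 0\<close>.\<close>
  have "two_ray_fun f x\<^sub>1 x\<^sub>2 = (\<lambda>t. f (max t 0 *\<^sub>R x\<^sub>1) + f (max (- t) 0 *\<^sub>R x\<^sub>2))"
    by (auto simp: two_ray_fun_def ray_fun_def max_def)
  then show ?thesis
    by (auto intro!: continuous_intros continuous_on_compose2[OF continuous])
qed

lemma two_ray_scale:
  assumes "f y = two_ray_fun f x\<^sub>1 x\<^sub>2 t" "0 < \<rho>"
  shows "f (\<rho> *\<^sub>R y) = two_ray_fun f x\<^sub>1 x\<^sub>2 (\<rho> * t)"
  using assms scale_eq_iff[of \<rho> y "t *\<^sub>R x\<^sub>1"] scale_eq_iff[of \<rho> y "(- t) *\<^sub>R x\<^sub>2"]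
  by (auto simp: two_ray_fun_def ray_fun_def zero_le_mult_iff)

text \<open>The implications on the sign of \<open>t\<close> guarantee that the parameter lies on a
  side whose sign \<open>f\<close> really takes.\<close>

lemma two_ray_surj:
  assumes "0 < f y \<Longrightarrow> 0 < f x\<^sub>1" "f y < 0 \<Longrightarrow> f x\<^sub>2 < 0"
  obtains t where "f y = two_ray_fun f x\<^sub>1 x\<^sub>2 t" "0 < t \<longrightarrow> 0 < f y" "t < 0 \<longrightarrow> f y < 0"
proof -
  consider "f y = 0" | "0 < f y" | "f y < 0" by linarith
  then show thesis
  proof cases
    case 1
    then show thesis using that[of 0] by simp
  next
    case 2
    then obtain t where "0 \<le> t" "f (t *\<^sub>R x\<^sub>1) = f y"
      using assms(1) ray_surj[of x\<^sub>1 y] by auto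
    with 2 show thesis using that[of t] by (simp add: two_ray_fun_def ray_fun_def)
  next
    case 3
    then obtain t where t: "0 \<le> t" "f (t *\<^sub>R x\<^sub>2) = f y"
      using assms(2) ray_surj_neg[of x\<^sub>2 y] by auto
    \<comment> \<open>\<open>two_ray_fun\<close> assigns 0 to the first ray, so the parameter
      \<open>- t\<close> must be strictly negative to select the second.\<close>
    with 3 have "t \<noteq> 0" by auto
    with 3 t show thesis using that[of "- t"] by (simp add: two_ray_fun_def ray_fun_def)
  qed
qed

text \<open>
  The interval depends on the signs that \<open>f\<close> takes: it is \<open>{0}\<close>, a closed half-line or the
  whole line.
\<close>

lemma two_ray_decomposition:
  assumes "0 < \<alpha>"
    and pos: "\<exists>x. 0 < f x \<Longrightarrow> 0 < f x\<^sub>1" and neg: "\<exists>x. f x < 0 \<Longrightarrow> f x\<^sub>2 < 0"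
  defines "I \<equiv> {t. (0 < t \<longrightarrow> (\<exists>x. 0 < f x)) \<and> (t < 0 \<longrightarrow> (\<exists>x. f x < 0))}"
    and "\<phi> \<equiv> \<lambda>t. two_ray_fun f x\<^sub>1 x\<^sub>2 (signed_powr (1 / \<alpha>) t)"
  shows "\<exists>p. decomposition f \<alpha> I \<phi> p" "strict_mono_on I \<phi>" "homeomorphic_onto_image I \<phi>"
proof -
  have I: "is_interval I"
    unfolding is_interval_1 I_def by auto
  have cont: "continuous_on I \<phi>"
    unfolding \<phi>_def using \<open>0 < \<alpha>\<close>
    by (intro continuous_on_compose2[OF continuous_on_two_ray continuous_on_signed_powr]) auto
  \<comment> \<open>Membership in \<open>I\<close> depends only on the sign, which signed roots
    preserve.\<close>
  have root: "signed_powr (1 / \<alpha>) t \<in> I" if "t \<in> I" for t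
    using that by (simp add: I_def signed_powr_pos_iff signed_powr_neg_iff)
  have "strict_mono_on I (two_ray_fun f x\<^sub>1 x\<^sub>2)"
    using pos neg by (intro two_ray_strict_mono) (auto simp: I_def)
  moreover have "strict_mono (signed_powr (1 / \<alpha>))"
    using \<open>0 < \<alpha>\<close> by (simp add: strict_mono_signed_powr)
  ultimately show mono: "strict_mono_on I \<phi>"
    using root by (simp add: monotone_on_def \<phi>_def)
  then have inj: "inj_on \<phi> I"
    by (rule strict_mono_on_imp_inj_on)
  show "homeomorphic_onto_image I \<phi>"
    using I cont inj by (rule homeomorphic_onto_image_real)
  show "\<exists>p. decomposition f \<alpha> I \<phi> p"
  proof (rule decomposition_of_parametrization[OF I cont inj continuous])
    show "range f \<subseteq> \<phi> ` I"
    proof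
      fix z assume "z \<in> range f"
      then obtain y where z: "z = f y" by auto
      obtain t where t: "f y = two_ray_fun f x\<^sub>1 x\<^sub>2 t" "0 < t \<longrightarrow> 0 < f y" "t < 0 \<longrightarrow> f y < 0"
        using two_ray_surj[of y x\<^sub>1 x\<^sub>2] pos neg by blast
      \<comment> \<open>The signed power is chosen to cancel the root inside
        \<open>\<phi>\<close>.\<close>
      have "signed_powr \<alpha> t \<in> I"
        using t(2,3) by (auto simp: I_def signed_powr_pos_iff signed_powr_neg_iff)
      moreover have "\<phi> (signed_powr \<alpha> t) = z"
        using \<open>0 < \<alpha>\<close> t z by (simp add: \<phi>_def signed_powr_inverse)
      ultimately show "z \<in> \<phi> ` I" by blast
    qed
    show "\<rho> * t \<in> I" if "t \<in> I" "0 < \<rho>" for t \<rho>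
      using that by (auto simp: I_def zero_less_mult_iff mult_less_0_iff)
    \<comment> \<open>The root turns the factor \<open>\<rho> powr \<alpha>\<close> back into
      \<open>\<rho>\<close>, the factor by which the two-ray parameter scales.\<close>
    show "f (\<rho> *\<^sub>R y) = \<phi> (\<rho> powr \<alpha> * t)" if "f y = \<phi> t" "0 < \<rho>" for y t \<rho>
      using two_ray_scale[of y x\<^sub>1 x\<^sub>2 "signed_powr (1 / \<alpha>) t" \<rho>] that \<open>0 < \<alpha>\<close>
      by (simp add: \<phi>_def signed_powr_mult powr_powr)
  qed
qed

lemma decomposition_exists:
  assumes "0 < \<alpha>"
  shows "\<exists>I \<phi> p. decomposition f \<alpha> I \<phi> p \<and> strict_mono_on I \<phi> \<and> homeomorphic_onto_image I \<phi>"
proof -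
  \<comment> \<open>Such a point always exists: any point will do if \<open>f\<close> takes no
    positive value.\<close>
  obtain x\<^sub>1 where "\<exists>x. 0 < f x \<Longrightarrow> 0 < f x\<^sub>1" by blast
  moreover obtain x\<^sub>2 where "\<exists>x. f x < 0 \<Longrightarrow> f x\<^sub>2 < 0" by blast
  ultimately show ?thesis
    using two_ray_decomposition[OF assms] by blast
qed

section \<open>Uniqueness of the decomposition\<close>

text \<open>Injectivity lets the inner function see only the level set, and homogeneity then fixes
  the factor. It is the same for both decompositions, so the ratio of \<open>p'\<close> to
  \<open>p\<close> does not change from \<open>x\<close> to \<open>y\<close>.\<close>

lemma decomposition_proportional:
  assumes p: "decomposition f \<alpha> I \<phi> p" and p': "decomposition f \<alpha> J \<phi>' p'"
    and "0 < t" "f y = f (t *\<^sub>R x)"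
  shows "p y = t powr \<alpha> * p x" "p' y = t powr \<alpha> * p' x"
proof -
  have "q y = t powr \<alpha> * q x" if "decomposition f \<alpha> K \<theta> q" for q K \<theta>
  proof -
    have "\<theta> (q y) = \<theta> (q (t *\<^sub>R x))" "inj_on \<theta> K" "range q \<subseteq> K" "pos_homogeneous \<alpha> q"
      using that assms(4) by (auto simp: decomposition_def bij_betw_def)
    then show ?thesis
      using \<open>0 < t\<close> by (metis inj_onD pos_homogeneous_def range_subsetD)
  qed
  with p p' show "p y = t powr \<alpha> * p x" "p' y = t powr \<alpha> * p' x" by blast+
qed

text \<open>Since \<open>p 0 = 0\<close> and \<open>f 0 = 0\<close>, also
  \<open>\<phi> 0 = 0\<close>; a strictly increasing function vanishing at 0 preserves
  signs.\<close>

lemma decomposition_same_sign: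
  assumes "decomposition f \<alpha> I \<phi> p" "strict_mono_on I \<phi>" "0 < \<alpha>"
  shows "0 < p y \<longleftrightarrow> 0 < f y" "p y < 0 \<longleftrightarrow> f y < 0"
proof -
  have p0: "p 0 = 0"
    using assms pos_homogeneous_zero[of \<alpha> p] by (simp add: decomposition_def)
  have f: "f x = \<phi> (p x)" and pI: "p x \<in> I" for x
    using assms(1) by (auto simp: decomposition_def)
  have "\<phi> 0 = 0" "0 \<in> I"
    using f[of 0] pI[of 0] p0 by simp_all
  then show "0 < p y \<longleftrightarrow> 0 < f y" "p y < 0 \<longleftrightarrow> f y < 0"
    using strict_mono_on_less[OF assms(2), of 0 "p y"] strict_mono_on_less[OF assms(2), of "p y" 0]
      f[of y] pI[of y] by simp_all
qed

text \<open>Where \<open>f\<close> is positive, every level set meets one fixed ray, so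
  \<open>p'\<close> is a constant multiple of \<open>p\<close> with slope \<open>p' x / p x\<close>;
  likewise where \<open>f\<close> is negative. Where \<open>f\<close> vanishes, so do
  \<open>p\<close> and \<open>p'\<close>.\<close>

lemma decomposition_unique:
  assumes "0 < \<alpha>"
    and p: "decomposition f \<alpha> I \<phi> p" "strict_mono_on I \<phi>"
    and p': "decomposition f \<alpha> J \<phi>' p'" "strict_mono_on J \<phi>'"
  shows "\<exists>\<psi>. piecewise_linear_on (range p) \<psi> \<and> p' = \<psi> \<circ> p"
proof -
  note sign = decomposition_same_sign[OF p assms(1)]
  note sign' = decomposition_same_sign[OF p' assms(1)]
  have "\<exists>a. \<forall>y. 0 < f y \<longrightarrow> p' y = a * p y"
  proof (cases "\<exists>x. 0 < f x")
    case True
    then obtain x where x: "0 < f x" ..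
    have "p' y = p' x / p x * p y" if y: "0 < f y" for y
    proof -
      obtain t where t: "0 \<le> t" "f (t *\<^sub>R x) = f y"
        using ray_surj[of x y] x y by auto
      with y have "0 < t" by (cases "t = 0") auto
      then show ?thesis
        using decomposition_proportional[OF p(1) p'(1), of t y x] t sign(1)[of x] x by simp
    qed
    then show ?thesis by blast
  qed auto
  then obtain a where a: "\<And>y. 0 < f y \<Longrightarrow> p' y = a * p y" by blast
  have "\<exists>b. \<forall>y. f y < 0 \<longrightarrow> p' y = b * p y"
  proof (cases "\<exists>x. f x < 0")
    case True
    then obtain x where x: "f x < 0" ..
    have "p' y = p' x / p x * p y" if y: "f y < 0" for y
    proof -
      obtain t where t: "0 \<le> t" "f (t *\<^sub>R x) = f y"
        using ray_surj_neg[of x y] x y by auto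
      with y have "0 < t" by (cases "t = 0") auto
      then show ?thesis
        using decomposition_proportional[OF p(1) p'(1), of t y x] t sign(2)[of x] x by simp
    qed
    then show ?thesis by blast
  qed auto
  then obtain b where b: "\<And>y. f y < 0 \<Longrightarrow> p' y = b * p y" by blast
  define \<psi> where "\<psi> t = (if 0 \<le> t then a * t else b * t)" for t
  have "p' y = \<psi> (p y)" for y
  proof -
    consider "0 < f y" | "f y < 0" | "f y = 0" by linarith
    then show ?thesis
    proof cases
      case 3
      then have "p y = 0" "p' y = 0"
        using sign[of y] sign'[of y] by auto
      then show ?thesis by (simp add: \<psi>_def)
    qed (use a b sign[of y] in \<open>auto simp: \<psi>_def\<close>)
  qed
  moreover have "piecewise_linear_on (range p) \<psi>"
    unfolding piecewise_linear_on_def \<psi>_def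
    by (intro conjI exI[of _ a] exI[of _ b]) auto
  ultimately show ?thesis by (auto simp: fun_eq_iff)
qed

section \<open>Global optima and the sign of the function\<close>

text \<open>A negative minimum is impossible: \<open>f\<close> strictly decreases along the ray
  through the minimizer, so doubling that point gives a smaller value.\<close>

lemma arg_min_nonneg:
  assumes "is_arg_min f (\<lambda>_. True) x"
  shows "0 \<le> f y"
proof (rule ccontr)
  assume "\<not> 0 \<le> f y"
  with assms have "f x < 0" by (metis is_arg_min_def not_le order_le_less_trans not_less)
  then have "f (2 *\<^sub>R x) < f (1 *\<^sub>R x)"
    using monotone_onD[OF ray_strict_antimono, of x 1 2] by (simp add: ray_fun_def)
  with assms show False by (simp add: is_arg_min_def)
qed

lemma arg_max_nonpos:
  assumes "is_arg_max f (\<lambda>_. True) x"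
  shows "f y \<le> 0"
  using continuous_scaling_invariant.arg_min_nonneg[OF uminus, of x y] assms
  by (simp add: is_arg_min_def is_arg_max_def)

lemma global_optimum_constant_sign:
  assumes "global_optimum f x"
  shows "(\<forall>y. 0 \<le> f y) \<or> (\<forall>y. f y \<le> 0)"
  using assms arg_min_nonneg arg_max_nonpos unfolding global_optimum_def by blast

lemma global_optimum_zero_iff: "global_optimum f 0 \<longleftrightarrow> (\<forall>y. 0 \<le> f y) \<or> (\<forall>y. f y \<le> 0)"
  by (auto simp: global_optimum_def is_arg_min_def is_arg_max_def not_less)

end


theorem theorem3p1:
  fixes f :: "real ^ 'n \<Rightarrow> real"
  assumes "continuous_on UNIV f"
    and "scaling_invariant f"
    and "f 0 = 0"
  shows
    "(\<forall>\<alpha>>0. \<exists>I \<phi> p. decomposition f \<alpha> I \<phi> p \<and> strict_mono_on I \<phi> \<and>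
        homeomorphic_onto_image I \<phi>) \<and>
     ((\<exists>x. f x \<noteq> 0) \<longrightarrow>
        (\<forall>\<alpha>>0. \<forall>I \<phi> p J \<phi>' p'.
          decomposition f \<alpha> I \<phi> p \<and> strict_mono_on I \<phi> \<and>
          decomposition f \<alpha> J \<phi>' p' \<and> strict_mono_on J \<phi>' \<longrightarrow>
          (\<exists>\<psi>. piecewise_linear_on (range p) \<psi> \<and> p' = \<psi> \<circ> p))) \<and>
     ((\<exists>x. global_optimum f x) \<longrightarrow>
        global_optimum f 0 \<and>
        (\<forall>x\<^sub>0. f x\<^sub>0 \<noteq> 0 \<longrightarrow>
          (\<exists>p. decomposition f 1 {0..} (ray_fun f x\<^sub>0) p) \<and>
          homeomorphic_onto_image {0..} (ray_fun f x\<^sub>0) \<and>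
          (is_arg_min f (\<lambda>_. True) 0 \<longrightarrow> strict_mono_on {0..} (ray_fun f x\<^sub>0)) \<and>
          (is_arg_max f (\<lambda>_. True) 0 \<longrightarrow> strict_antimono_on {0..} (ray_fun f x\<^sub>0)) \<and>
          (\<forall>k. class_C_on k f UNIV \<longrightarrow> class_C_on k (ray_fun f x\<^sub>0) {0..}))) \<and>
     ((\<nexists>x. global_optimum f x) \<longrightarrow>
        (\<exists>x\<^sub>1 x\<^sub>2. f x\<^sub>1 > 0 \<and> f x\<^sub>2 < 0) \<and>
        (\<forall>x\<^sub>1 x\<^sub>2. f x\<^sub>1 > 0 \<and> f x\<^sub>2 < 0 \<longrightarrow>
          (\<exists>p. decomposition f 1 UNIV (two_ray_fun f x\<^sub>1 x\<^sub>2) p) \<and>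
          strict_mono_on UNIV (two_ray_fun f x\<^sub>1 x\<^sub>2) \<and>
          homeomorphic_onto_image UNIV (two_ray_fun f x\<^sub>1 x\<^sub>2)))"
proof (intro conjI)
  have f: "continuous_scaling_invariant f"
    using assms by unfold_locales
  show "\<forall>\<alpha>>0. \<exists>I \<phi> p. decomposition f \<alpha> I \<phi> p \<and> strict_mono_on I \<phi> \<and>
      homeomorphic_onto_image I \<phi>"
    using continuous_scaling_invariant.decomposition_exists[OF f] by blast
  show "(\<exists>x. f x \<noteq> 0) \<longrightarrow>
      (\<forall>\<alpha>>0. \<forall>I \<phi> p J \<phi>' p'.
        decomposition f \<alpha> I \<phi> p \<and> strict_mono_on I \<phi> \<and>
        decomposition f \<alpha> J \<phi>' p' \<and> strict_mono_on J \<phi>' \<longrightarrow>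
        (\<exists>\<psi>. piecewise_linear_on (range p) \<psi> \<and> p' = \<psi> \<circ> p))"
    using continuous_scaling_invariant.decomposition_unique[OF f] by blast
  show "(\<exists>x. global_optimum f x) \<longrightarrow>
      global_optimum f 0 \<and>
      (\<forall>x\<^sub>0. f x\<^sub>0 \<noteq> 0 \<longrightarrow>
        (\<exists>p. decomposition f 1 {0..} (ray_fun f x\<^sub>0) p) \<and>
        homeomorphic_onto_image {0..} (ray_fun f x\<^sub>0) \<and>
        (is_arg_min f (\<lambda>_. True) 0 \<longrightarrow> strict_mono_on {0..} (ray_fun f x\<^sub>0)) \<and>
        (is_arg_max f (\<lambda>_. True) 0 \<longrightarrow> strict_antimono_on {0..} (ray_fun f x\<^sub>0)) \<and>
        (\<forall>k. class_C_on k f UNIV \<longrightarrow> class_C_on k (ray_fun f x\<^sub>0) {0..}))"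
  proof (intro impI conjI allI)
    assume "\<exists>x. global_optimum f x"
    then have sgn: "(\<forall>y. 0 \<le> f y) \<or> (\<forall>y. f y \<le> 0)"
      using continuous_scaling_invariant.global_optimum_constant_sign[OF f] by blast
    then show "global_optimum f 0"
      by (simp add: continuous_scaling_invariant.global_optimum_zero_iff[OF f])
    fix x\<^sub>0
    assume x0: "f x\<^sub>0 \<noteq> 0"
    show "\<exists>p. decomposition f 1 {0..} (ray_fun f x\<^sub>0) p"
      using x0 sgn by (rule continuous_scaling_invariant.ray_decomposition[OF f])
    show "homeomorphic_onto_image {0..} (ray_fun f x\<^sub>0)"
      using x0 by (rule continuous_scaling_invariant.ray_homeomorphic[OF f])
    show "strict_mono_on {0..} (ray_fun f x\<^sub>0)" if "is_arg_min f (\<lambda>_. True) 0"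
      using continuous_scaling_invariant.arg_min_nonneg[OF f that, of x\<^sub>0] x0
      by (intro continuous_scaling_invariant.ray_strict_mono[OF f]) simp
    show "strict_antimono_on {0..} (ray_fun f x\<^sub>0)" if "is_arg_max f (\<lambda>_. True) 0"
      using continuous_scaling_invariant.arg_max_nonpos[OF f that, of x\<^sub>0] x0
      by (intro continuous_scaling_invariant.ray_strict_antimono[OF f]) simp
    show "class_C_on k (ray_fun f x\<^sub>0) {0..}" if "class_C_on k f UNIV" for k
      using that by (rule class_C_on_ray_fun)
  qed
  show "(\<nexists>x. global_optimum f x) \<longrightarrow>
      (\<exists>x\<^sub>1 x\<^sub>2. f x\<^sub>1 > 0 \<and> f x\<^sub>2 < 0) \<and>
      (\<forall>x\<^sub>1 x\<^sub>2. f x\<^sub>1 > 0 \<and> f x\<^sub>2 < 0 \<longrightarrow>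
        (\<exists>p. decomposition f 1 UNIV (two_ray_fun f x\<^sub>1 x\<^sub>2) p) \<and>
        strict_mono_on UNIV (two_ray_fun f x\<^sub>1 x\<^sub>2) \<and>
        homeomorphic_onto_image UNIV (two_ray_fun f x\<^sub>1 x\<^sub>2))"
  proof (intro impI conjI allI; (elim conjE)?)
    assume "\<nexists>x. global_optimum f x"
    then show "\<exists>x\<^sub>1 x\<^sub>2. f x\<^sub>1 > 0 \<and> f x\<^sub>2 < 0"
      using continuous_scaling_invariant.global_optimum_zero_iff[OF f] by (meson not_le)
  next
    fix x\<^sub>1 x\<^sub>2
    assume x: "f x\<^sub>1 > 0" "f x\<^sub>2 < 0"
    \<comment> \<open>When both signs occur, the interval of the general decomposition is the whole
      line.\<close>
    then have UNIV: "{t::real. (0 < t \<longrightarrow> (\<exists>x. 0 < f x)) \<and> (t < 0 \<longrightarrow> (\<exists>x. f x < 0))} = UNIV"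
      by blast
    \<comment> \<open>For degree 1 the signed root is the identity, so the outer function is
      \<open>two_ray_fun\<close> itself.\<close>
    note two_ray = continuous_scaling_invariant.two_ray_decomposition[OF f, of 1 x\<^sub>1 x\<^sub>2,
        unfolded UNIV, simplified, OF x]
    show "\<exists>p. decomposition f 1 UNIV (two_ray_fun f x\<^sub>1 x\<^sub>2) p"
      "strict_mono_on UNIV (two_ray_fun f x\<^sub>1 x\<^sub>2)"
      "homeomorphic_onto_image UNIV (two_ray_fun f x\<^sub>1 x\<^sub>2)"
      using two_ray by blast+
  qed
qed

end
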